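(* Let $(X,S)$ be the Jordan scheme $J_{16}$, i.e. the Jordan scheme of order $16$ constructed (as in the context) from an elementary abelian $2$-group $G$ of order $4$ and a $\{1,-1\}$-matrix $M=(M_{x,y})_{x,y\in G}$ satisfying $M_{x,xz}M_{x,yz}M_{y,xz}M_{y,yz}=-1$ for all $x,y,z\in G$ with $x\neq y$. Then its real adjacency Jordan algebra $\mathbb{R}S$ satisfies \[ \mathbb{R}S\cong 8\,\mathbb{R}\oplus(\mathbb{R}\oplus_f\mathbb{R}^4)\] as Jordan algebras, where $8\,\mathbb{R}$ denotes the direct sum of $8$ copies of $\mathbb{R}$ and $f(\boldsymbol{x},\boldsymbol{y})=\sum_{i=1}^4x_iy_i$ for $\boldsymbol{x}=(x_1,\dots,x_4),\boldsymbol{y}=(y_1,\dots,y_4)\in\mathbb{R}^4$.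
   Context: Jordan product: for square matrices $A,B$ of the same order, $A*B:=\frac{1}{2}(AB+BA)$. Jordan scheme: let $X$ be a finite set and let $S=\{A_0=I,A_1,\dots,A_d\}\subset M_X(\mathbb{C})$ be a set of symmetric $\{0,1\}$-matrices. $(X,S)$ is a Jordan scheme if (1) $\sum_{i=0}^d A_i=J$, the all-one matrix, and (2) there exist $p_{ij}^k\in\frac12\mathbb{Z}$ such that $A_i*A_j=\sum_{k=0}^d p_{ij}^kA_k$ for all $i,j$. Its real adjacency Jordan algebra is $\mathbb{R}S:=\bigoplus_{i=0}^d\mathbb{R}A_i$ with the product $*$. A (real) Jordan algebra is an $\mathbb{R}$-vector space with a bilinear product $*$ satisfying $a*b=b*a$ and $a^{*2}*(b*a)=(a^{*2}*b)*a$, where $a^{*2}=a*a$. Direct sums of Jordan algebras carry the componentwise product. $\mathbb{R}\oplus_fV$: for a real vector space $V$ with positive definite symmetric bilinear form $f$, this is the vector space $\mathbb{R}\oplus V$ (with basis element $1$ of $\mathbb{R}$) with product $(\alpha1+\boldsymbol{x})*(\beta1+\boldsymbol{y})=(\alpha\beta+f(\boldsymbol{x},\boldsymbol{y}))1+(\beta\boldsymbol{x}+\alpha\boldsymbol{y})$. Construction of the Jordan scheme from $(G,M)$: let $I_2$ and $J_2$ be the identity and all-one matrices of order $2$, $K_2=J_2-I_2$, $C_2=\langle h\rangle$ the group of order $2$, $H=C_2\times G$, and $E_{(s,t),(u,v)}$ the matrix units of $M_H(\mathbb{C})$. For $(s,t)\in H$ and $x,y\in G$ put \[ L_{x,y}=L^{(s,t)}_{x,y}:=\begin{cases}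 I_2 & \text{if } s=1,\ t=1,\\ J_2 & \text{if } s=1,\ t\neq 1,\\ I_2 & \text{if } s\neq 1 \text{ and } M_{x,y}=1,\\ K_2 & \text{if } s\neq 1\text{ and } M_{x,y}=-1,\end{cases}\] \[\sigma_{(s,t)}:=\sum_{g\in G}E_{(1,g),(s,gt)}\otimes L_{g,gt}+\sum_{g\in G}E_{(h,g),(hs,gt)}\otimes L_{gt,g},\] and let $\sigma'_{(s,t)}$ be the same expression with $L_{g,gt}$ and $L_{gt,g}$ replaced by $L_{g,gt}K_2$ and $L_{gt,g}K_2$ respectively. Then \[ S:=\{\sigma_{(1,1)},\sigma_{(1,1)}'\}\cup\{\sigma_{(1,t)} : t\in G,\ t\neq 1\}\cup\{\sigma_{(h,t)},\sigma_{(h,t)}' : t\in G\},\] a Jordan scheme on $4|G|$ points. For $|G|=4$ all admissible $M$ give combinatorially isomorphic Jordan schemes (i.e. equal up to relabeling the points), and $J_{16}$ denotes this scheme. An admissible $M$ for $G=\{1,a,b,ab\}$ (indices in this order) is \[\begin{pmatrix}1&1&1&1\\1&-1&1&-1\\1&-1&-1&1\\1&1&-1&-1\end{pmatrix}.\] *)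

theory Defs
  imports "HOL-Analysis.Analysis"
begin

section \<open>Jordan algebras\<close>

text \<open>A Jordan algebra is given by a carrier (a subspace of the ambient real vector space) and a
  product on that carrier; the product is irrelevant outside the carrier.\<close>

definition jordan_algebra :: "'a::real_vector set \<Rightarrow> ('a \<Rightarrow> 'a \<Rightarrow> 'a) \<Rightarrow> bool" where
  "jordan_algebra V m \<longleftrightarrow>
     subspace V \<and>
     (\<forall>a\<in>V. \<forall>b\<in>V. m a b \<in> V) \<and>
     (\<forall>a\<in>V. \<forall>b\<in>V. \<forall>c\<in>V. m (a + b) c = m a c + m b c) \<and>
     (\<forall>a\<in>V. \<forall>b\<in>V. \<forall>c\<in>V. m a (b + c) = m a b + m a c) \<and>
     (\<forall>r::real. \<forall>a\<in>V. \<forall>b\<in>V. m (r *\<^sub>R a) b = r *\<^sub>R m a b \<and> m a (r *\<^sub>R b) = r *\<^sub>R m a b) \<and>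
     (\<forall>a\<in>V. \<forall>b\<in>V. m a b = m b a) \<and>
     (\<forall>a\<in>V. \<forall>b\<in>V. m (m a a) (m b a) = m (m (m a a) b) a)"

definition jordan_algebra_iso ::
    "'a::real_vector set \<Rightarrow> ('a \<Rightarrow> 'a \<Rightarrow> 'a) \<Rightarrow> 'b::real_vector set \<Rightarrow> ('b \<Rightarrow> 'b \<Rightarrow> 'b) \<Rightarrow> bool" where
  "jordan_algebra_iso V m W n \<longleftrightarrow>
     jordan_algebra V m \<and> jordan_algebra W n \<and>
     (\<exists>\<phi>. bij_betw \<phi> V W \<and>
          (\<forall>a\<in>V. \<forall>b\<in>V. \<phi> (a + b) = \<phi> a + \<phi> b) \<and>
          (\<forall>r::real. \<forall>a\<in>V. \<phi> (r *\<^sub>R a) = r *\<^sub>R \<phi> a) \<and>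
          (\<forall>a\<in>V. \<forall>b\<in>V. \<phi> (m a b) = n (\<phi> a) (\<phi> b)))"

definition direct_sum_product ::
    "('a \<Rightarrow> 'a \<Rightarrow> 'a) \<Rightarrow> ('b \<Rightarrow> 'b \<Rightarrow> 'b) \<Rightarrow> 'a \<times> 'b \<Rightarrow> 'a \<times> 'b \<Rightarrow> 'a \<times> 'b" where
  "direct_sum_product m n = (\<lambda>(a, b) (c, d). (m a c, n b d))"

text \<open>The product of \<open>\<real> \<oplus>\<^sub>f V\<close>, with \<open>\<alpha>1 + x\<close> represented as the pair \<open>(\<alpha>, x)\<close>.\<close>

definition spin_product ::
    "('v::real_vector \<Rightarrow> 'v \<Rightarrow> real) \<Rightarrow> real \<times> 'v \<Rightarrow> real \<times> 'v \<Rightarrow> real \<times> 'v" where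
  "spin_product f = (\<lambda>(\<alpha>, x) (\<beta>, y). (\<alpha> * \<beta> + f x y, \<beta> *\<^sub>R x + \<alpha> *\<^sub>R y))"


section \<open>Jordan schemes\<close>

definition jordan_product :: "complex^'x^'x \<Rightarrow> complex^'x^'x \<Rightarrow> complex^'x^'x" where
  "jordan_product A B = (1/2) *\<^sub>R (A ** B + B ** A)"

definition all_ones :: "complex^'n^'n" where
  "all_ones = (\<chi> i j. 1)"

text \<open>The point set is the whole finite index type.\<close>

definition jordan_scheme :: "(complex^'x^'x) set \<Rightarrow> bool" where
  "jordan_scheme S \<longleftrightarrow>
     finite S \<and> mat 1 \<in> S \<and>
     (\<forall>A\<in>S. transpose A = A \<and> (\<forall>i j. A $ i $ j \<in> {0, 1})) \<and>
     (\<Sum>A\<in>S. A) = all_ones \<and>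
     (\<exists>p :: complex^'x^'x \<Rightarrow> complex^'x^'x \<Rightarrow> complex^'x^'x \<Rightarrow> real.
        \<forall>A\<in>S. \<forall>B\<in>S.
          (\<forall>C\<in>S. 2 * p A B C \<in> \<int>) \<and>
          jordan_product A B = (\<Sum>C\<in>S. p A B C *\<^sub>R C))"

text \<open>Members of a Jordan scheme are \<open>{0,1}\<close>-matrices with pairwise disjoint supports, so (apart from
  a possible zero matrix) the real span is the direct sum of the lines \<open>\<real>A\<close>, \<open>A \<in> S\<close>. Complex
  matrices form a real vector space by restriction of scalars.\<close>

definition adjacency_algebra :: "(complex^'x^'x) set \<Rightarrow> (complex^'x^'x) set" where
  "adjacency_algebra S = span S"


section \<open>The scheme constructed from a group and a sign matrix\<close>

text \<open>Abelian groups are written additively: the group is a type \<open>'g\<close>, the group \<open>C\<^sub>2\<close> is the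
  additive group of the two-element type \<open>2\<close> (so its identity is \<open>0\<close> and \<open>h\<close> is \<open>1\<close>), and
  \<open>H = C\<^sub>2 \<times> G\<close> is the type \<open>2 \<times> 'g\<close>.\<close>

definition admissible :: "('g::{ab_group_add,finite} \<Rightarrow> 'g \<Rightarrow> int) \<Rightarrow> bool" where
  "admissible M \<longleftrightarrow>
     (\<forall>x y. M x y = 1 \<or> M x y = -1) \<and>
     (\<forall>x y z. x \<noteq> y \<longrightarrow>
        M x (x + z) * M x (y + z) * M y (x + z) * M y (y + z) = -1)"

definition matrix_unit :: "'n \<Rightarrow> 'n \<Rightarrow> complex^'n^'n" where
  "matrix_unit p q = (\<chi> i j. if i = p \<and> j = q then 1 else 0)"

definition kronecker :: "complex^'m^'m \<Rightarrow> complex^'n^'n \<Rightarrow> complex^('m \<times> 'n)^('m \<times> 'n)" where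
  "kronecker A B = (\<chi> i j. A $ fst i $ fst j * B $ snd i $ snd j)"

definition I2 :: "complex^2^2" where "I2 = mat 1"
definition J2 :: "complex^2^2" where "J2 = all_ones"
definition K2 :: "complex^2^2" where "K2 = J2 - I2"

definition L_block ::
    "('g \<Rightarrow> 'g \<Rightarrow> int) \<Rightarrow> 2 \<times> 'g \<Rightarrow> 'g \<Rightarrow> 'g::{ab_group_add,finite} \<Rightarrow> complex^2^2" where
  "L_block M = (\<lambda>(s, t) x y.
     if s = 0 then (if t = 0 then I2 else J2)
     else (if M x y = 1 then I2 else K2))"

definition sigma ::
    "('g \<Rightarrow> 'g \<Rightarrow> int) \<Rightarrow> 2 \<times> 'g::{ab_group_add,finite} \<Rightarrow> complex^((2 \<times> 'g) \<times> 2)^((2 \<times> 'g) \<times> 2)" where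
  "sigma M = (\<lambda>(s, t).
     (\<Sum>g\<in>UNIV. kronecker (matrix_unit (0, g) (s, g + t)) (L_block M (s, t) g (g + t))) +
     (\<Sum>g\<in>UNIV. kronecker (matrix_unit (1, g) (1 + s, g + t)) (L_block M (s, t) (g + t) g)))"

definition sigma' ::
    "('g \<Rightarrow> 'g \<Rightarrow> int) \<Rightarrow> 2 \<times> 'g::{ab_group_add,finite} \<Rightarrow> complex^((2 \<times> 'g) \<times> 2)^((2 \<times> 'g) \<times> 2)" where
  "sigma' M = (\<lambda>(s, t).
     (\<Sum>g\<in>UNIV. kronecker (matrix_unit (0, g) (s, g + t)) (L_block M (s, t) g (g + t) ** K2)) +
     (\<Sum>g\<in>UNIV. kronecker (matrix_unit (1, g) (1 + s, g + t)) (L_block M (s, t) (g + t) g ** K2)))"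

definition scheme_of ::
    "('g \<Rightarrow> 'g \<Rightarrow> int) \<Rightarrow> (complex^((2 \<times> 'g) \<times> 2)^((2 \<times> 'g::{ab_group_add,finite}) \<times> 2)) set" where
  "scheme_of M =
     {sigma M (0, 0), sigma' M (0, 0)} \<union>
     {sigma M (0, t) | t. t \<noteq> 0} \<union>
     {sigma M (1, t) | t. True} \<union> {sigma' M (1, t) | t. True}"

end

theory Submission
  imports Defs
begin

text \<open>Why the theorem holds. Cut the \<open>2 \<times> 2\<close> blocks by the two orthogonal idempotents
  \<open>plus_proj = J\<^sub>2/2\<close> and \<open>minus_proj = (I\<^sub>2 - K\<^sub>2)/2\<close>. Every matrix of the scheme is a sum or a
  difference of two of the matrices
    \<open>reg h = P\<^sub>h \<otimes> plus_proj\<close> (\<open>h \<in> H\<close>), \<open>spin_unit = I \<otimes> minus_proj\<close> and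
    \<open>gen M t = W\<^sub>t \<otimes> minus_proj\<close> (\<open>t \<in> G\<close>),
  where \<open>P\<^sub>h\<close> is the permutation matrix of translation by \<open>h\<close> and \<open>W\<^sub>t\<close> is a signed permutation matrix
  whose signs are entries of \<open>M\<close>. So \<open>\<real>S\<close> is the span of these 13 matrices, and their Jordan products
  are easy to find. The \<open>reg h\<close> multiply like the group \<open>H\<close>, and they annihilate the other two families
  because the idempotents are orthogonal. Admissibility of \<open>M\<close> says precisely that distinct \<open>W\<^sub>s\<close> and
  \<open>W\<^sub>t\<close> anticommute; as also \<open>W\<^sub>t\<^sup>2 = I\<close>, their Jordan products form the Kronecker delta, which is the
  multiplication table of \<open>\<real> \<oplus>\<^sub>f \<real>\<^sup>4\<close> (lemma \<open>clifford_relation\<close>).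

  The group algebra \<open>\<real>H\<close> of the elementary abelian group of order 8 splits into 8 copies of \<open>\<real>\<close> by
  the idempotents of its real characters. A set of orthogonal idempotents together with a unit and spin
  generators defines a multiplicative linear map from the direct sum, and this map is injective as soon
  as the idempotents and the unit are nonzero and there are at least two generators (locale
  \<open>jordan_frame\<close>). Its range is the span of the basis, hence \<open>\<real>S\<close>.

  That \<open>S\<close> is a Jordan scheme with half-integral structure constants comes from the same table: the
  basis matrices lie in \<open>1/2 \<int>S\<close>, and a product of two of them is zero or again one of them, so products
  of scheme matrices, which are sums of basis matrices up to sign, stay in \<open>1/2 \<int>S\<close>.\<close>

section \<open>Special Jordan algebras\<close>

lemma scaleR_matrix_mult_left:
  fixes A :: "complex^'n^'m"
  shows "(r *\<^sub>R A) ** B = r *\<^sub>R (A ** B)"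
  by (simp add: vec_eq_iff matrix_matrix_mult_def scaleR_sum_right)

lemma scaleR_matrix_mult_right:
  fixes A :: "complex^'n^'m"
  shows "A ** (r *\<^sub>R B) = r *\<^sub>R (A ** B)"
  by (simp add: vec_eq_iff matrix_matrix_mult_def scaleR_sum_right)

lemma matrix_mult_distrib_right:
  fixes A :: "complex^'n^'m"
  shows "(A + B) ** C = A ** C + B ** C"
  by (simp add: vec_eq_iff matrix_matrix_mult_def sum.distrib distrib_right)

lemma bilinear_jordan_product: "bilinear jordan_product"
  unfolding bilinear_def jordan_product_def
  by (auto intro!: linearI simp: scaleR_matrix_mult_left scaleR_matrix_mult_right
      matrix_mult_distrib_right matrix_add_ldistrib algebra_simps)

lemma jordan_product_commute: "jordan_product A B = jordan_product B A"
  by (simp add: jordan_product_def add.commute)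

lemma jordan_product_self: "jordan_product A A = A ** A"
  by (simp add: jordan_product_def flip: scaleR_2)

text \<open>Both sides become the same sum of words in \<open>A\<close> and \<open>B\<close>, because \<open>A * A\<close> is the ordinary square of \<open>A\<close>:
  the special Jordan identity.\<close>

lemma jordan_identity:
  "jordan_product (jordan_product A A) (jordan_product B A) =
   jordan_product (jordan_product (jordan_product A A) B) A"
  unfolding jordan_product_self
  by (simp add: jordan_product_def scaleR_matrix_mult_left scaleR_matrix_mult_right
      matrix_mult_distrib_right matrix_add_ldistrib matrix_mul_assoc algebra_simps)

lemma jordan_algebra_of_matrices:
  assumes "subspace V" and "\<And>A B. A \<in> V \<Longrightarrow> B \<in> V \<Longrightarrow> jordan_product A B \<in> V"
  shows "jordan_algebra V jordan_product"
  unfolding jordan_algebra_def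
  by (intro conjI ballI allI assms jordan_identity jordan_product_commute
      bilinear_ladd bilinear_radd bilinear_lmul bilinear_rmul bilinear_jordan_product)

text \<open>Stated for an embedding \<open>\<psi>\<close> of the model \<open>n\<close> into \<open>V\<close>, the direction given by
  explicit linear combinations of a basis. The Jordan algebra laws of \<open>n\<close> are pulled back along \<open>\<psi>\<close>.\<close>

lemma jordan_algebra_iso_range:
  fixes \<psi> :: "'b::real_vector \<Rightarrow> 'a::real_vector"
  assumes V: "jordan_algebra V m"
    and lin: "linear \<psi>" and inj: "inj \<psi>" and range: "range \<psi> = V"
    and mult: "\<And>x y. \<psi> (n x y) = m (\<psi> x) (\<psi> y)"
  shows "jordan_algebra_iso V m UNIV n"
proof -
  have in_V: "\<psi> x \<in> V" for x
    using range by blast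
  have eq: "x = y" if "\<psi> x = \<psi> y" for x y
    using inj that by (rule injD)
  have V_laws:
    "\<And>a b c. \<lbrakk>a \<in> V; b \<in> V; c \<in> V\<rbrakk> \<Longrightarrow> m (a + b) c = m a c + m b c"
    "\<And>a b c. \<lbrakk>a \<in> V; b \<in> V; c \<in> V\<rbrakk> \<Longrightarrow> m a (b + c) = m a b + m a c"
    "\<And>r a b. \<lbrakk>a \<in> V; b \<in> V\<rbrakk> \<Longrightarrow> m (r *\<^sub>R a) b = r *\<^sub>R m a b"
    "\<And>r a b. \<lbrakk>a \<in> V; b \<in> V\<rbrakk> \<Longrightarrow> m a (r *\<^sub>R b) = r *\<^sub>R m a b"
    "\<And>a b. \<lbrakk>a \<in> V; b \<in> V\<rbrakk> \<Longrightarrow> m a b = m b a"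
    "\<And>a b. \<lbrakk>a \<in> V; b \<in> V\<rbrakk> \<Longrightarrow> m (m a a) (m b a) = m (m (m a a) b) a"
    using V unfolding jordan_algebra_def by blast+
  note hom = mult linear_add[OF lin] linear_scale[OF lin]
  have W_laws: "n (x + y) z = n x z + n y z" "n x (y + z) = n x y + n x z"
      "n (r *\<^sub>R x) y = r *\<^sub>R n x y" "n x (r *\<^sub>R y) = r *\<^sub>R n x y" "n x y = n y x"
      "n (n x x) (n y x) = n (n (n x x) y) x" for x y z r
    by (rule eq, unfold hom, rule V_laws; rule in_V)+
  have W: "jordan_algebra UNIV n"
    unfolding jordan_algebra_def by (intro conjI ballI allI subspace_UNIV UNIV_I W_laws)
  have inv: "inv \<psi> (\<psi> x) = x" for x
    using inj by simp
  have "bij_betw (inv \<psi>) V UNIV"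
    using bij_betw_inv_into[of \<psi> UNIV V] inj range by (simp add: bij_betw_def)
  moreover have "inv \<psi> (\<psi> x + \<psi> y) = x + y" "inv \<psi> (r *\<^sub>R \<psi> x) = r *\<^sub>R x"
      "inv \<psi> (m (\<psi> x) (\<psi> y)) = n x y" for x y r
    by (metis inv linear_add[OF lin]) (metis inv linear_scale[OF lin], metis inv mult)
  ultimately show ?thesis
    unfolding jordan_algebra_iso_def using V W
    by (intro conjI exI[of _ "inv \<psi>"]) (simp_all only: range[symmetric] ball_simps inv, simp_all)
qed

section \<open>Systems of idempotents and spin generators\<close>

definition frame_map ::
    "('i::finite \<Rightarrow> 'a::real_vector) \<Rightarrow> 'a \<Rightarrow> ('j::finite \<Rightarrow> 'a) \<Rightarrow> (real^'i) \<times> (real \<times> (real^'j)) \<Rightarrow> 'a" where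
  "frame_map E N w = (\<lambda>(u, \<alpha>, x). (\<Sum>i\<in>UNIV. u $ i *\<^sub>R E i) + (\<alpha> *\<^sub>R N + (\<Sum>j\<in>UNIV. x $ j *\<^sub>R w j)))"

lemma linear_frame_map: "linear (frame_map E N w)"
  by (auto intro!: linearI simp: frame_map_def scaleR_add_left sum.distrib scaleR_sum_right
      scaleR_add_right)

text \<open>The multiplication table of the standard basis of a direct sum of copies of \<open>\<real>\<close> and one spin factor.
  The locale is about elements of an arbitrary commutative algebra with this table.\<close>

locale jordan_frame =
  fixes m :: "'a::real_vector \<Rightarrow> 'a \<Rightarrow> 'a"
    and E :: "'i::finite \<Rightarrow> 'a" and N :: 'a and w :: "'j::finite \<Rightarrow> 'a"
  assumes bilinear: "bilinear m" and commute: "\<And>a b. m a b = m b a"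
    and EE: "\<And>i k. m (E i) (E k) = (if i = k then E i else 0)"
    and EN: "\<And>i. m (E i) N = 0" and Ew: "\<And>i j. m (E i) (w j) = 0"
    and NN: "m N N = N" and Nw: "\<And>j. m N (w j) = w j"
    and ww: "\<And>j l. m (w j) (w l) = (if j = l then N else 0)"
begin

lemma linear_left: "linear (\<lambda>a. m a b)"
  using bilinear by (simp add: bilinear_def)

lemma linear_right: "linear (m a)"
  using bilinear by (simp add: bilinear_def)

lemma NE: "m N (E i) = 0" and wE: "m (w j) (E i) = 0" and wN: "m (w j) N = w j"
  by (simp_all add: commute[of N "E i"] commute[of "w j"] EN Ew Nw)

lemmas expand = linear_add[OF linear_left] linear_sum[OF linear_left] linear_scale[OF linear_left]
  linear_add[OF linear_right] linear_sum[OF linear_right] linear_scale[OF linear_right]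

lemma frame_map_E: "m (frame_map E N w (u, \<alpha>, x)) (E i) = u $ i *\<^sub>R E i"
  by (simp add: frame_map_def expand EE NE wE if_distrib[of "scaleR _"] cong: if_cong)

lemma frame_map_N:
  "m (frame_map E N w (u, \<alpha>, x)) N = \<alpha> *\<^sub>R N + (\<Sum>j\<in>UNIV. x $ j *\<^sub>R w j)"
  by (simp add: frame_map_def expand EN NN wN)

lemma frame_map_w: "m (frame_map E N w (u, \<alpha>, x)) (w j) = \<alpha> *\<^sub>R w j + x $ j *\<^sub>R N"
  by (simp add: frame_map_def expand Ew Nw ww if_distrib[of "scaleR _"] cong: if_cong)

text \<open>The three lemmas above give the products with basis elements; by linearity in the second argument
  they determine the product.\<close>

lemma frame_map_mult:
  "frame_map E N w (direct_sum_product (\<lambda>u v. \<chi> i. u $ i * v $ i)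
     (spin_product (\<lambda>x y. \<Sum>j\<in>UNIV. x $ j * y $ j)) p q)
   = m (frame_map E N w p) (frame_map E N w q)"
proof -
  obtain u \<alpha> x where p: "p = (u, \<alpha>, x)" by (cases p)
  obtain v \<beta> y where q: "q = (v, \<beta>, y)" by (cases q)
  have "m (frame_map E N w p) (frame_map E N w q) =
      (\<Sum>i\<in>UNIV. v $ i *\<^sub>R (u $ i *\<^sub>R E i)) + (\<beta> *\<^sub>R (\<alpha> *\<^sub>R N + (\<Sum>j\<in>UNIV. x $ j *\<^sub>R w j))
        + (\<Sum>j\<in>UNIV. y $ j *\<^sub>R (\<alpha> *\<^sub>R w j + x $ j *\<^sub>R N)))"
    unfolding p q frame_map_def[of E N w, THEN fun_cong, of "(v, \<beta>, y)"] prod.case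
    by (simp only: linear_add[OF linear_right] linear_sum[OF linear_right]
        linear_scale[OF linear_right] frame_map_E frame_map_N frame_map_w)
  also have "\<dots> = frame_map E N w (direct_sum_product (\<lambda>u v. \<chi> i. u $ i * v $ i)
     (spin_product (\<lambda>x y. \<Sum>j\<in>UNIV. x $ j * y $ j)) p q)"
    by (simp add: p q frame_map_def direct_sum_product_def spin_product_def scaleR_add_right
        scaleR_add_left sum.distrib scaleR_sum_right scaleR_sum_left mult.commute)
  finally show ?thesis ..
qed

text \<open>Products with \<open>E i\<close> and \<open>w j\<close> isolate the coordinates: the first gives \<open>u = 0\<close>, the second the relation
  \<open>\<alpha> w\<^sub>j + x\<^sub>j N = 0\<close>. One generator alone could be \<open>N\<close> or \<open>-N\<close>, and then this relation would not force
  \<open>\<alpha> = x\<^sub>j = 0\<close>; multiplying it by a second generator, orthogonal to \<open>w\<^sub>j\<close>, leaves \<open>x\<^sub>j w\<^sub>l = 0\<close>.\<close>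

lemma inj_frame_map:
  assumes E0: "\<And>i. E i \<noteq> 0" and N0: "N \<noteq> 0" and two: "CARD('j) \<ge> 2"
  shows "inj (frame_map E N w)"
proof (subst linear_injective_0[OF linear_frame_map], safe)
  fix u \<alpha> and x :: "real^'j"
  assume 0: "frame_map E N w (u, \<alpha>, x) = 0"
  have m0: "m 0 a = 0" for a
    using linear_0[OF linear_left] .
  have u: "u = 0"
    using frame_map_E[of u \<alpha> x] E0 by (simp add: 0 m0 vec_eq_iff)
  have w0: "w j \<noteq> 0" for j
    using ww[of j j] N0 by (auto simp: m0)
  have rel: "\<alpha> *\<^sub>R w j + x $ j *\<^sub>R N = 0" for j
    using frame_map_w[of u \<alpha> x j] by (simp add: 0 m0)
  have x: "x $ j = 0" for j
  proof -
    obtain l where "l \<noteq> j"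
      using two by (metis (full_types) One_nat_def UNIV_I card_le_Suc0_iff_eq finite not_less_eq_eq
          numeral_2_eq_2)
    then have "m (\<alpha> *\<^sub>R w j + x $ j *\<^sub>R N) (w l) = x $ j *\<^sub>R w l"
      by (simp add: expand ww Nw)
    then show ?thesis
      using w0 by (simp add: rel m0)
  qed
  moreover have "\<alpha> = 0"
    using rel[of undefined] x w0 by simp
  ultimately show "(u, \<alpha>, x) = 0"
    using u by (simp add: vec_eq_iff zero_prod_def)
qed

end

lemma range_frame_map:
  "range (frame_map E N w) = span (range E \<union> {N} \<union> range w)" (is "_ = span ?B")
proof
  show "range (frame_map E N w) \<subseteq> span ?B"
    by (auto simp: frame_map_def intro!: span_add span_sum span_scale intro: span_base)
  have "E i = frame_map E N w (axis i 1, 0, 0)" for i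
    by (simp add: frame_map_def axis_def if_distrib[of "\<lambda>r. r *\<^sub>R _"] cong: if_cong)
  moreover have "N = frame_map E N w (0, 1, 0)"
    by (simp add: frame_map_def)
  moreover have "w j = frame_map E N w (0, 0, axis j 1)" for j
    by (simp add: frame_map_def axis_def if_distrib[of "\<lambda>r. r *\<^sub>R _"] cong: if_cong)
  ultimately have "?B \<subseteq> range (frame_map E N w)"
    by (auto intro: range_eqI)
  then show "span ?B \<subseteq> range (frame_map E N w)"
    by (rule span_minimal) (simp add: linear_subspace_image[OF linear_frame_map])
qed

section \<open>Idempotents from a character table\<close>

text \<open>A nondegenerate symmetric pairing identifies a group of exponent 2 with its own character group:
  \<open>\<kappa> c\<close> is the character indexed by \<open>c\<close>. Symmetry makes the two orthogonality relations of characters one.\<close>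

locale character_pairing =
  fixes \<kappa> :: "'h::{ab_group_add,finite} \<Rightarrow> 'h \<Rightarrow> real"
  assumes exponent2: "\<And>h::'h. h + h = 0"
    and sym: "\<And>c h. \<kappa> c h = \<kappa> h c"
    and zero [simp]: "\<And>c. \<kappa> c 0 = 1"
    and add: "\<And>c h k. \<kappa> c (h + k) = \<kappa> c h * \<kappa> c k"
    and nondegenerate: "\<And>c. c \<noteq> 0 \<Longrightarrow> \<exists>h. \<kappa> c h \<noteq> 1"
begin

lemma zero_left: "\<kappa> 0 h = 1"
  using sym[of 0 h] by (simp only: zero)

text \<open>Translation by an element on which the character is not 1 multiplies the sum by that value and
  leaves it unchanged.\<close>

lemma sum_character: "(\<Sum>h\<in>UNIV. \<kappa> c h) = (if c = 0 then CARD('h) else 0)"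
proof (cases "c = 0")
  case True
  then show ?thesis
    by (simp add: zero_left)
next
  case False
  then obtain k where k: "\<kappa> c k \<noteq> 1"
    using nondegenerate by blast
  have "(\<Sum>h\<in>UNIV. \<kappa> c h) = (\<Sum>h\<in>UNIV. \<kappa> c (k + h))"
    by (rule sum.reindex_bij_betw[symmetric]) (rule bij_plus)
  also have "\<dots> = \<kappa> c k * (\<Sum>h\<in>UNIV. \<kappa> c h)"
    by (simp add: add sum_distrib_left)
  finally show ?thesis
    using k False by simp
qed

lemma orthogonality:
  "(\<Sum>h\<in>UNIV. \<kappa> c h * \<kappa> d h) = (if c = d then CARD('h) else 0)"
proof -
  have "- d = d"
    using exponent2 by (rule minus_unique)
  then have "c + d = 0 \<longleftrightarrow> c = d"
    using eq_neg_iff_add_eq_0[of c d] by simp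
  moreover have "\<kappa> c h * \<kappa> d h = \<kappa> (c + d) h" for h
    by (simp only: add sym[of _ h])
  ultimately show ?thesis
    by (simp add: sum_character)
qed

definition idempotent :: "('h \<Rightarrow> 'a::real_vector) \<Rightarrow> 'h \<Rightarrow> 'a" where
  "idempotent R c = (1 / CARD('h)) *\<^sub>R (\<Sum>h\<in>UNIV. \<kappa> c h *\<^sub>R R h)"

lemma idempotent_inversion: "R h = (\<Sum>c\<in>UNIV. \<kappa> h c *\<^sub>R idempotent R c)"
proof -
  have "(\<Sum>c\<in>UNIV. \<kappa> h c *\<^sub>R idempotent R c) =
      (1 / CARD('h)) *\<^sub>R (\<Sum>k\<in>UNIV. (\<Sum>c\<in>UNIV. \<kappa> h c * \<kappa> k c) *\<^sub>R R k)"
    unfolding idempotent_def scaleR_sum_right scaleR_sum_left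
    by (subst sum.swap) (simp add: sym[of _ "_ :: 'h"] mult.commute)
  also have "\<dots> = R h"
    by (simp add: orthogonality if_distrib[of "\<lambda>r. r *\<^sub>R _"] if_distrib[of real] cong: if_cong)
  finally show ?thesis ..
qed

lemma span_idempotent: "span (range (idempotent R)) = span (range R)"
proof (rule span_eq[THEN iffD2], safe)
  show "idempotent R c \<in> span (range R)" for c
    unfolding idempotent_def by (intro span_scale span_sum span_base rangeI)
  show "R h \<in> span (range (idempotent R))" for h
    by (subst idempotent_inversion[of R h]) (intro span_scale span_sum span_base rangeI)
qed

text \<open>Each \<open>R k\<close> acts on \<open>idempotent R d\<close> as the scalar \<open>\<kappa> d k\<close>, so the product of two idempotents is an
  inner product of characters.\<close>

lemma idempotent_mult:
  assumes bil: "bilinear m" and R: "\<And>h k. m (R h) (R k) = R (h + k)"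
  shows "m (idempotent R c) (idempotent R d) = (if c = d then idempotent R c else 0)"
proof -
  have lin: "linear (\<lambda>a. m a b)" "linear (m b)" for b
    using bil by (simp_all add: bilinear_def)
  have eigen: "m (R k) (idempotent R d) = \<kappa> d k *\<^sub>R idempotent R d" for k
  proof -
    have cancel: "k + (k + h) = h" for h
      unfolding add.assoc[symmetric] exponent2 by simp
    have "m (R k) (idempotent R d) = (1 / CARD('h)) *\<^sub>R (\<Sum>h\<in>UNIV. \<kappa> d h *\<^sub>R R (k + h))"
      by (simp add: idempotent_def linear_scale[OF lin(2)] linear_sum[OF lin(2)] R)
    also have "(\<Sum>h\<in>UNIV. \<kappa> d h *\<^sub>R R (k + h)) = (\<Sum>h\<in>UNIV. \<kappa> d (k + h) *\<^sub>R R (k + (k + h)))"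
      by (rule sum.reindex_bij_betw[symmetric]) (rule bij_plus)
    also have "\<dots> = \<kappa> d k *\<^sub>R (\<Sum>h\<in>UNIV. \<kappa> d h *\<^sub>R R h)"
      by (simp add: add scaleR_sum_right cancel)
    finally show ?thesis
      by (simp add: idempotent_def)
  qed
  have "m (idempotent R c) (idempotent R d) =
      (1 / CARD('h)) *\<^sub>R (\<Sum>h\<in>UNIV. \<kappa> c h * \<kappa> d h) *\<^sub>R idempotent R d"
    by (subst idempotent_def)
      (simp only: linear_scale[OF lin(1)] linear_sum[OF lin(1)] eigen scaleR_sum_left scaleR_scaleR)
  then show ?thesis
    by (simp add: orthogonality)
qed

end

section \<open>The character table of an elementary abelian group of order eight\<close>

lemma two_cases: "(a::2) = 0 \<or> a = 1"
  using exhaust_2[of a] by auto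

lemma two_add_self: "a + a = (0::2)"
  using two_cases[of a] by auto

text \<open>On the group of order 4, the nondegenerate alternating form over the field with two elements, written
  multiplicatively: \<open>u\<close> and \<open>v\<close> pair to 1 exactly when they are linearly dependent.\<close>

definition symplectic :: "'g::ab_group_add \<Rightarrow> 'g \<Rightarrow> real" where
  "symplectic u v = (if u = 0 \<or> v = 0 \<or> u = v then 1 else -1)"

definition pairing :: "2 \<times> 'g::ab_group_add \<Rightarrow> 2 \<times> 'g \<Rightarrow> real" where
  "pairing = (\<lambda>(s, u) (t, v). (if s = 1 \<and> t = 1 then -1 else 1) * symplectic u v)"

context
  assumes elementary_abelian: "\<forall>x::'g::{ab_group_add,finite}. x + x = 0" and order: "CARD('g) = 4"
begin

lemma four_group_uminus: "- x = (x :: 'g)"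
  using elementary_abelian by (simp add: minus_unique)

lemma four_group_eq_iff: "x + y = 0 \<longleftrightarrow> x = (y :: 'g)"
  using eq_neg_iff_add_eq_0[of x y] by (simp add: four_group_uminus)

lemma four_group_third:
  fixes u v w :: 'g
  assumes "u \<noteq> 0" "v \<noteq> 0" "w \<noteq> 0" "u \<noteq> v" "u \<noteq> w" "v \<noteq> w"
  shows "w = u + v"
proof -
  have "card {0, u, v, w} = CARD('g)"
    using assms order by auto
  then have "{0, u, v, w} = UNIV"
    by (intro card_subset_eq) auto
  then have "u + v \<in> {0, u, v, w}"
    by simp
  then show ?thesis
    using assms by (auto simp: four_group_eq_iff)
qed

text \<open>In each degenerate case the claim is read off the definition. Otherwise \<open>u, v, w\<close> are the three nonzero
  elements, \<open>v + w = u\<close>, and both sides are 1.\<close>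

lemma symplectic_add: "symplectic u (v + w) = symplectic u v * symplectic u (w :: 'g)"
proof -
  consider "u = 0" | "v = 0" | "w = 0" | "u = v" | "u = w" | "v = w"
    | "u \<noteq> 0" "v \<noteq> 0" "u \<noteq> v" "w = u + v"
    using four_group_third[of u v w] by blast
  then show ?thesis
  proof cases
    case 7
    then have "v + w = u"
      using elementary_abelian by (simp add: add.left_commute)
    then show ?thesis
      using 7 by (simp add: symplectic_def four_group_eq_iff)
  qed (use elementary_abelian four_group_eq_iff in \<open>auto simp: symplectic_def\<close>)
qed

lemma symplectic_nondegenerate:
  assumes "u \<noteq> (0 :: 'g)"
  shows "\<exists>v. symplectic u v \<noteq> 1"
proof -
  have "card {0, u} < CARD('g)"
    using order by (simp add: card_insert_if)
  then have "{0, u} \<noteq> UNIV"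
    by force
  then obtain v where "v \<noteq> 0" "v \<noteq> u"
    by blast
  then show ?thesis
    using assms by (intro exI[of _ v]) (simp add: symplectic_def)
qed

lemma character_pairing: "character_pairing (pairing :: 2 \<times> 'g \<Rightarrow> _)"
proof
  fix c h k :: "2 \<times> 'g"
  show "h + h = 0"
    using elementary_abelian by (cases h) (simp add: two_add_self zero_prod_def)
  show "pairing c h = pairing h c"
    by (auto simp: pairing_def symplectic_def split: prod.split)
  show "pairing c 0 = 1"
    by (auto simp: pairing_def symplectic_def zero_prod_def split: prod.split)
  show "pairing c (h + k) = pairing c h * pairing c k"
    using two_cases[of "fst h"] two_cases[of "fst k"]
    by (cases c; cases h; cases k) (auto simp: pairing_def symplectic_add)
  assume "c \<noteq> 0"
  show "\<exists>h. pairing c h \<noteq> 1"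
  proof (cases "snd c = 0")
    case True
    with \<open>c \<noteq> 0\<close> have "fst c = 1"
      using two_cases[of "fst c"] by (auto simp: prod_eq_iff)
    with True show ?thesis
      by (intro exI[of _ "(1, 0)"]) (simp add: pairing_def symplectic_def split_beta)
  next
    case False
    then obtain v where "symplectic (snd c) v \<noteq> 1"
      using symplectic_nondegenerate by blast
    then show ?thesis
      by (intro exI[of _ "(0, v)"]) (simp add: pairing_def split_beta)
  qed
qed

end

section \<open>The basis of permutation and Clifford matrices\<close>

lemma kronecker_mult: "kronecker A B ** kronecker C D = kronecker (A ** C) (B ** D)"
  by (simp add: vec_eq_iff kronecker_def matrix_matrix_mult_def sum_product mult_ac
      sum.cartesian_product split_beta flip: UNIV_Times_UNIV)

lemma kronecker_add_left: "kronecker (A + A') B = kronecker A B + kronecker A' B"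
  by (simp add: vec_eq_iff kronecker_def distrib_right)

lemma kronecker_scaleR_left: "kronecker (r *\<^sub>R A) B = r *\<^sub>R kronecker A B"
  by (simp add: vec_eq_iff kronecker_def)

lemma kronecker_zero [simp]: "kronecker A 0 = 0" "kronecker 0 B = 0"
  by (simp_all add: vec_eq_iff kronecker_def)

text \<open>This reduces the multiplication table to matrices indexed by \<open>H\<close>: both orders of multiplication give
  the same second factor, which can be taken out of the sum.\<close>

lemma jordan_product_kronecker:
  assumes "B ** D = D ** B"
  shows "jordan_product (kronecker A B) (kronecker C D) = kronecker (jordan_product A C) (B ** D)"
  by (simp add: jordan_product_def kronecker_mult assms kronecker_add_left kronecker_scaleR_left)

definition shift_matrix :: "('h::{ab_group_add,finite} \<Rightarrow> complex) \<Rightarrow> 'h \<Rightarrow> ((complex, 'h) vec, 'h) vec" where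
  "shift_matrix a h = (\<chi> p q. if q = p + h then a p else 0)"

lemma shift_matrix_mult:
  "shift_matrix a h ** shift_matrix b k = shift_matrix (\<lambda>p. a p * b (p + h)) (h + k)"
proof -
  have "(\<Sum>r\<in>UNIV. (if r = p + h then a p else 0) * (if q = r + k then b r else 0)) =
      (\<Sum>r\<in>UNIV. if r = p + h then a p * (if q = r + k then b r else 0) else 0)" for p q
    by (rule sum.cong) auto
  then show ?thesis
    by (simp add: vec_eq_iff shift_matrix_def matrix_matrix_mult_def add.assoc)
qed

lemma shift_matrix_add:
  "shift_matrix a h + shift_matrix b h = shift_matrix (\<lambda>p. a p + b p) h"
  by (simp add: vec_eq_iff shift_matrix_def)

lemma shift_matrix_zero: "shift_matrix (\<lambda>_. 0) h = 0"
  by (simp add: vec_eq_iff shift_matrix_def)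

lemma shift_matrix_0: "shift_matrix (\<lambda>_. 1) 0 = mat 1"
  by (auto simp: vec_eq_iff shift_matrix_def mat_def)

definition plus_proj :: "complex^2^2" where "plus_proj = (1/2) *\<^sub>R J2"

definition minus_proj :: "complex^2^2" where "minus_proj = (1/2) *\<^sub>R (I2 - K2)"

lemma I2_entry: "I2 $ i $ j = (if i = j then 1 else 0)"
  and J2_entry: "J2 $ i $ j = 1"
  and K2_entry: "K2 $ i $ j = (if i = j then 0 else 1)"
  by (simp_all add: K2_def I2_def J2_def all_ones_def mat_def)

lemma plus_proj_entry: "plus_proj $ i $ j = 1/2"
  unfolding plus_proj_def vector_scaleR_component J2_entry by (simp add: scaleR_conv_of_real)

lemma minus_proj_entry: "minus_proj $ i $ j = (if i = j then 1/2 else -1/2)"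
  unfolding minus_proj_def vector_scaleR_component vector_minus_component I2_entry K2_entry
  by (simp add: scaleR_conv_of_real)

lemma sum_two: "sum f (UNIV :: 2 set) = f 0 + f 1"
proof -
  have "(UNIV :: 2 set) = {0, 1}"
    using two_cases by blast
  then have "sum f (UNIV :: 2 set) = sum f {0, 1}"
    by (rule arg_cong)
  then show ?thesis
    by simp
qed

lemma proj_mult:
  "plus_proj ** plus_proj = plus_proj" "minus_proj ** minus_proj = minus_proj"
  "plus_proj ** minus_proj = 0" "minus_proj ** plus_proj = 0"
  using two_cases
  by (auto simp: vec_eq_iff matrix_matrix_mult_def sum_two plus_proj_entry minus_proj_entry)

definition reg :: "2 \<times> 'g::{ab_group_add,finite} \<Rightarrow> complex^((2 \<times> 'g) \<times> 2)^((2 \<times> 'g) \<times> 2)" where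
  "reg h = kronecker (shift_matrix (\<lambda>_. 1) h) plus_proj"

definition spin_unit :: "complex^((2 \<times> 'g::{ab_group_add,finite}) \<times> 2)^((2 \<times> 'g) \<times> 2)" where
  "spin_unit = kronecker (mat 1) minus_proj"

text \<open>The signs of the matrix \<open>W\<^sub>t\<close>, row by row. The two arguments of \<open>M\<close> are exchanged on the second copy
  of \<open>G\<close>, which makes \<open>W\<^sub>t\<close> symmetric.\<close>

definition signs :: "('g \<Rightarrow> 'g \<Rightarrow> int) \<Rightarrow> 'g::ab_group_add \<Rightarrow> 2 \<times> 'g \<Rightarrow> int" where
  "signs M t p = (if fst p = 0 then M (snd p) (snd p + t) else M (snd p + t) (snd p))"

definition clifford ::
    "('g \<Rightarrow> 'g \<Rightarrow> int) \<Rightarrow> 'g::{ab_group_add,finite} \<Rightarrow> complex^(2 \<times> 'g)^(2 \<times> 'g)" where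
  "clifford M t = shift_matrix (\<lambda>p. of_int (signs M t p)) (1, t)"

definition gen ::
    "('g \<Rightarrow> 'g \<Rightarrow> int) \<Rightarrow> 'g::{ab_group_add,finite} \<Rightarrow> complex^((2 \<times> 'g) \<times> 2)^((2 \<times> 'g) \<times> 2)" where
  "gen M t = kronecker (clifford M t) minus_proj"

lemma signs_pm: "admissible M \<Longrightarrow> signs M t p = 1 \<or> signs M t p = -1"
  by (simp add: admissible_def signs_def)

lemma jordan_product_mat_1 [simp]: "jordan_product (mat 1) A = A"
  by (simp add: jordan_product_def flip: scaleR_2)

lemma reg_reg: "jordan_product (reg h) (reg k) = reg (h + k)"
  unfolding reg_def jordan_product_kronecker[OF refl] proj_mult
  by (simp add: jordan_product_def shift_matrix_mult add.commute flip: scaleR_2)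

lemma reg_spin_unit: "jordan_product (reg h) spin_unit = 0"
  by (simp add: reg_def spin_unit_def jordan_product_kronecker proj_mult)

lemma reg_gen: "jordan_product (reg h) (gen M t) = 0"
  by (simp add: reg_def gen_def jordan_product_kronecker proj_mult)

lemma spin_unit_spin_unit: "jordan_product spin_unit spin_unit = spin_unit"
  by (simp add: spin_unit_def jordan_product_kronecker proj_mult)

lemma spin_unit_gen: "jordan_product spin_unit (gen M t) = gen M t"
  by (simp add: spin_unit_def gen_def jordan_product_kronecker proj_mult)

context
  fixes M :: "'g::{ab_group_add,finite} \<Rightarrow> 'g \<Rightarrow> int"
  assumes elementary_abelian: "\<forall>x::'g. x + x = 0" and M: "admissible M"
begin

text \<open>The left-hand side is an entry of \<open>W\<^sub>s W\<^sub>t + W\<^sub>t W\<^sub>s\<close>. It is a sum of two signs whose product is the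
  product of four entries of \<open>M\<close> in the admissibility condition, which is \<open>-1\<close>.\<close>

lemma signs_anticommute:
  assumes "s \<noteq> t"
  shows "signs M s p * signs M t (p + (1, s)) + signs M t p * signs M s (p + (1, t)) = 0"
proof -
  obtain a g where p: "p = (a, g)" by (cases p)
  have pm: "M x y = 1 \<or> M x y = -1" for x y
    using M by (simp add: admissible_def)
  have adm: "x \<noteq> y \<Longrightarrow> M x (x + z) * M x (y + z) * M y (x + z) * M y (y + z) = -1" for x y z
    using M by (simp add: admissible_def)
  have zz: "z + z = 0" "z + (z + w) = w" for z w :: 'g
    using elementary_abelian by (simp_all flip: add.assoc)
  have neq: "g \<noteq> g + s + t"
    using assms elementary_abelian by (metis add.assoc add_left_cancel add.right_neutral)
  show ?thesis
  proof (cases "a = 0")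
    case True
    (* admissibility for the rows g and g + s + t, with z = s *)
    have "M g (g + s) * M g (g + t) * M (g + s + t) (g + s) * M (g + s + t) (g + t) = -1"
      using adm[OF neq, of s] by (simp add: zz ac_simps)
    then show ?thesis
      using pm[of g "g + s"] pm[of g "g + t"] pm[of "g + s + t" "g + s"] pm[of "g + s + t" "g + t"]
      by (auto simp: p True signs_def zz ac_simps)
  next
    case False
    then have a: "a = 1"
      using two_cases by blast
    (* admissibility for the rows g + s and g + t, again with z = s *)
    have "M (g + s) g * M (g + s) (g + s + t) * M (g + t) g * M (g + t) (g + s + t) = -1"
      using adm[of "g + s" "g + t" s] assms by (simp add: zz ac_simps)
    then show ?thesis
      using pm[of "g + s" g] pm[of "g + s" "g + s + t"] pm[of "g + t" g] pm[of "g + t" "g + s + t"]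
      by (auto simp: p a signs_def zz ac_simps)
  qed
qed

lemma signs_shift: "signs M t (p + (1, t)) = signs M t p"
  using two_cases[of "fst p"] elementary_abelian by (auto simp: signs_def add.assoc)

text \<open>Translations by \<open>(1, s)\<close> and \<open>(1, t)\<close> commute, so both orders of multiplication give signed
  translations by the same group element and only the signs have to be compared.\<close>

lemma clifford_relation:
  "jordan_product (clifford M s) (clifford M t) = (if s = t then mat 1 else 0)"
proof (cases "s = t")
  case True
  have "(of_int (signs M t p) :: complex) * of_int (signs M t p) = 1" for p
    using signs_pm[OF M, of t p] by auto
  moreover have "(1, t) + (1, t) = (0 :: 2 \<times> 'g)"
    using elementary_abelian by (simp add: zero_prod_def)
  ultimately show ?thesis
    by (simp add: True jordan_product_self clifford_def shift_matrix_mult signs_shift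
        shift_matrix_0)
next
  case False
  have "(of_int (signs M s p) * of_int (signs M t (p + (1, s)))
      + of_int (signs M t p) * of_int (signs M s (p + (1, t))) :: complex) = 0" for p
    using signs_anticommute[OF False, of p] by (metis of_int_0 of_int_add of_int_mult)
  with False show ?thesis
    by (simp add: jordan_product_def clifford_def shift_matrix_mult add.commute[of t s]
        shift_matrix_add shift_matrix_zero)
qed

lemma gen_gen: "jordan_product (gen M s) (gen M t) = (if s = t then spin_unit else 0)"
  by (simp add: gen_def spin_unit_def jordan_product_kronecker proj_mult clifford_relation)

end

section \<open>The scheme in terms of the basis\<close>

text \<open>Row \<open>p\<close> of each sum has at most one nonzero block, in column \<open>fst p + (s, t)\<close>, so the two sums collapse
  to a case distinction. It applies to both \<open>sigma\<close> and \<open>sigma'\<close>.\<close>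

lemma block_sum_entry:
  fixes p q :: "(2 \<times> 'g::{ab_group_add,finite}) \<times> 2"
  shows "((\<Sum>g\<in>UNIV. kronecker (matrix_unit (0, g) (s, g + t)) (F g)) +
      (\<Sum>g\<in>UNIV. kronecker (matrix_unit (1, g) (1 + s, g + t)) (F' g))) $ p $ q =
    (if fst q = fst p + (s, t)
     then (if fst (fst p) = 0 then F (snd (fst p)) else F' (snd (fst p))) $ snd p $ snd q else 0)"
proof -
  obtain a g i where p: "p = ((a, g), i)" by (metis prod.collapse)
  have pick: "(\<Sum>x\<in>UNIV. kronecker (matrix_unit (b, x) (c, x + t)) (F x)) $ p $ q =
      (if a = b \<and> fst q = (c, g + t) then F g $ i $ snd q else 0)" for b c F
  proof -
    have "(\<Sum>x\<in>UNIV. kronecker (matrix_unit (b, x) (c, x + t)) (F x)) $ p $ q =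
        (\<Sum>x\<in>UNIV. if g = x then (if a = b \<and> fst q = (c, x + t) then F x $ i $ snd q else 0) else 0)"
      unfolding sum_component
      by (rule sum.cong[OF refl]) (auto simp: kronecker_def matrix_unit_def p)
    then show ?thesis
      by simp
  qed
  show ?thesis
    unfolding vector_add_component pick using two_cases[of a] by (auto simp: p)
qed

lemma L_block_entry:
  "L_block M h x y $ i $ j =
    (if fst h = 0 then (if snd h = 0 then (if i = j then 1 else 0) else 1)
     else if (M x y = 1) = (i = j) then 1 else 0)"
  by (cases h) (simp add: L_block_def I2_entry J2_entry K2_entry)

lemma mult_K2_entry: "(A ** K2) $ i $ 0 = A $ i $ 1" "(A ** K2) $ i $ 1 = A $ i $ 0"
  by (simp_all add: matrix_matrix_mult_def sum_two K2_entry)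

lemma add_pair_zero [simp]: "x + (0, 0) = (x :: 'a::monoid_add \<times> 'b::monoid_add)"
  by (cases x) simp

lemma sigma_even_entry:
  "sigma M (0, t) $ p $ q =
    (if fst q = fst p + (0, t) \<and> (t = 0 \<longrightarrow> snd p = snd q) then 1 else 0)"
  unfolding sigma_def prod.case block_sum_entry by (auto simp: L_block_entry)

lemma sigma'_0_entry:
  "sigma' M (0, 0) $ p $ q = (if fst q = fst p \<and> snd p \<noteq> snd q then 1 else 0)"
  using two_cases[of "snd p"] two_cases[of "snd q"]
  unfolding sigma'_def prod.case block_sum_entry
  by (auto simp: mult_K2_entry L_block_entry)

lemma sigma_odd_entry:
  "sigma M (1, t) $ p $ q =
    (if fst q = fst p + (1, t) \<and> (signs M t (fst p) = 1) = (snd p = snd q) then 1 else 0)"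
  unfolding sigma_def prod.case block_sum_entry by (auto simp: L_block_entry signs_def)

lemma sigma'_odd_entry:
  "sigma' M (1, t) $ p $ q =
    (if fst q = fst p + (1, t) \<and> (signs M t (fst p) = 1) \<noteq> (snd p = snd q) then 1 else 0)"
  using two_cases[of "snd p"] two_cases[of "snd q"]
  unfolding sigma'_def prod.case block_sum_entry
  by (auto simp: mult_K2_entry L_block_entry signs_def)

lemmas sigma_entries = sigma_even_entry sigma'_0_entry sigma_odd_entry sigma'_odd_entry

lemma reg_entry: "reg h $ p $ q = (if fst q = fst p + h then 1/2 else 0)"
  by (simp add: reg_def kronecker_def shift_matrix_def plus_proj_entry)

lemma spin_unit_entry:
  "spin_unit $ p $ q = (if fst q = fst p then if snd p = snd q then 1/2 else -1/2 else 0)"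
  by (auto simp: spin_unit_def kronecker_def mat_def minus_proj_entry)

lemma gen_entry:
  "gen M t $ p $ q = (if fst q = fst p + (1, t)
     then of_int (signs M t (fst p)) * (if snd p = snd q then 1/2 else -1/2) else 0)"
  by (auto simp: gen_def clifford_def kronecker_def shift_matrix_def minus_proj_entry)

lemma sigma_0_eq: "sigma M (0, 0) = reg (0, 0) + spin_unit"
  and sigma'_0_eq: "sigma' M (0, 0) = reg (0, 0) - spin_unit"
  unfolding vec_eq_iff vector_add_component vector_minus_component sigma_entries reg_entry
    spin_unit_entry
  by auto

lemma sigma_even_eq: "t \<noteq> 0 \<Longrightarrow> sigma M (0, t) = reg (0, t) + reg (0, t)"
  unfolding vec_eq_iff vector_add_component sigma_entries reg_entry by auto

lemma sigma_odd_eq: "sigma M (1, t) = reg (1, t) + gen M t"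
  and sigma'_odd_eq: "sigma' M (1, t) = reg (1, t) - gen M t"
  if "admissible M"
proof -
  have "(of_int (signs M t p) :: complex) = (if signs M t p = 1 then 1 else -1)" for p
    using signs_pm[OF that, of t p] by auto
  then show "sigma M (1, t) = reg (1, t) + gen M t" "sigma' M (1, t) = reg (1, t) - gen M t"
    unfolding vec_eq_iff vector_add_component vector_minus_component sigma_entries reg_entry
      gen_entry
    by auto
qed

definition basis_matrices ::
    "('g \<Rightarrow> 'g \<Rightarrow> int) \<Rightarrow> (complex^((2 \<times> 'g) \<times> 2)^((2 \<times> 'g::{ab_group_add,finite}) \<times> 2)) set" where
  "basis_matrices M = range reg \<union> {spin_unit} \<union> range (gen M)"

lemma scheme_decomposition:
  assumes "admissible M" and "A \<in> scheme_of M"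
  shows "\<exists>B\<in>basis_matrices M. \<exists>C\<in>basis_matrices M. A = B + C \<or> A = B - C"
proof -
  have basis: "reg h \<in> basis_matrices M" "spin_unit \<in> basis_matrices M"
      "gen M t \<in> basis_matrices M" for h t
    unfolding basis_matrices_def by blast+
  consider "A = reg (0, 0) + spin_unit" | "A = reg (0, 0) - spin_unit"
    | t where "A = reg (0, t) + reg (0, t)" | t where "A = reg (1, t) + gen M t"
    | t where "A = reg (1, t) - gen M t"
    using assms(2) sigma_even_eq unfolding scheme_of_def sigma_0_eq sigma'_0_eq
      sigma_odd_eq[OF assms(1)] sigma'_odd_eq[OF assms(1)]
    by blast
  then show ?thesis
    by cases (use basis in blast)+
qed

text \<open>Conversely, each basis matrix is half of a signed sum of scheme matrices. The denominator 2 is the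
  source of the half-integers among the structure constants.\<close>

lemma basis_half_sum:
  assumes "admissible M" and "B \<in> basis_matrices M"
  shows "\<exists>A\<in>scheme_of M. \<exists>A'\<in>scheme_of M.
    B = (1/2) *\<^sub>R (A + A') \<or> B = (1/2) *\<^sub>R (A - A') \<or> B = (1/2) *\<^sub>R A"
proof -
  have in_S: "sigma M (0, t) \<in> scheme_of M" "sigma M (1, t) \<in> scheme_of M"
      "sigma' M (1, t) \<in> scheme_of M" "sigma' M (0, 0) \<in> scheme_of M" for t
    unfolding scheme_of_def by blast+
  note eqs = sigma_0_eq sigma'_0_eq sigma_even_eq sigma_odd_eq[OF assms(1)] sigma'_odd_eq[OF assms(1)]
  consider s t where "B = reg (s, t)" | "B = spin_unit" | t where "B = gen M t"
    using assms(2) unfolding basis_matrices_def by auto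
  then show ?thesis
  proof cases
    case (1 s t)
    consider "s = 0" "t = 0" | "s = 0" "t \<noteq> 0" | "s = 1"
      using two_cases by blast
    then show ?thesis
    proof cases
      case 1
      with \<open>B = reg (s, t)\<close> have "B = (1/2) *\<^sub>R (sigma M (0, 0) + sigma' M (0, 0))"
        by (simp add: eqs flip: scaleR_2)
      then show ?thesis using in_S by blast
    next
      case 2
      with \<open>B = reg (s, t)\<close> have "B = (1/2) *\<^sub>R sigma M (0, t)"
        by (simp add: eqs flip: scaleR_2)
      then show ?thesis using in_S by blast
    next
      case 3
      with \<open>B = reg (s, t)\<close> have "B = (1/2) *\<^sub>R (sigma M (1, t) + sigma' M (1, t))"
        by (simp add: eqs flip: scaleR_2)
      then show ?thesis using in_S by blast
    qed
  next
    case 2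
    then have "B = (1/2) *\<^sub>R (sigma M (0, 0) - sigma' M (0, 0))"
      by (simp add: eqs flip: scaleR_2)
    then show ?thesis using in_S by blast
  next
    case (3 t)
    then have "B = (1/2) *\<^sub>R (sigma M (1, t) - sigma' M (1, t))"
      by (simp add: eqs flip: scaleR_2)
    then show ?thesis using in_S by blast
  qed
qed

lemma span_basis_matrices:
  assumes "admissible M"
  shows "span (basis_matrices M) = span (scheme_of M)"
proof (rule span_eq[THEN iffD2], safe)
  fix B assume "B \<in> basis_matrices M"
  then show "B \<in> span (scheme_of M)"
    using basis_half_sum[OF assms] by (metis span_add span_base span_diff span_scale)
next
  fix A assume "A \<in> scheme_of M"
  then show "A \<in> span (basis_matrices M)"
    using scheme_decomposition[OF assms] by (metis span_add span_base span_diff)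
qed

section \<open>The scheme is a Jordan scheme\<close>

text \<open>The subgroup \<open>1/2 \<int>S\<close>; a Jordan scheme is required to have all its products in it.\<close>

definition half_lattice :: "'a::real_vector set \<Rightarrow> 'a set" where
  "half_lattice S = {\<Sum>C\<in>S. q C *\<^sub>R C | q. \<forall>C\<in>S. 2 * q C \<in> \<int>}"

lemma half_latticeI:
  "x = (\<Sum>C\<in>S. q C *\<^sub>R C) \<Longrightarrow> \<forall>C\<in>S. 2 * q C \<in> \<int> \<Longrightarrow> x \<in> half_lattice S"
  unfolding half_lattice_def by blast

lemma half_lattice_zero: "0 \<in> half_lattice S"
  by (rule half_latticeI[of _ "\<lambda>_. 0"]) simp_all

lemma half_lattice_half:
  assumes "finite S" and "A \<in> S"
  shows "(1/2) *\<^sub>R A \<in> half_lattice S"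
proof -
  have "(1/2) *\<^sub>R A = (\<Sum>C\<in>S. (if C = A then 1/2 else 0) *\<^sub>R C)"
    using assms by (simp add: if_distrib[of "\<lambda>r. r *\<^sub>R _"] cong: if_cong)
  then show ?thesis
    by (rule half_latticeI) simp
qed

lemma half_lattice_add:
  assumes "x \<in> half_lattice S" and "y \<in> half_lattice S"
  shows "x + y \<in> half_lattice S"
proof -
  obtain q r where "x = (\<Sum>C\<in>S. q C *\<^sub>R C)" "\<forall>C\<in>S. 2 * q C \<in> \<int>"
      "y = (\<Sum>C\<in>S. r C *\<^sub>R C)" "\<forall>C\<in>S. 2 * r C \<in> \<int>"
    using assms unfolding half_lattice_def by blast
  then have "x + y = (\<Sum>C\<in>S. (q C + r C) *\<^sub>R C)" "\<forall>C\<in>S. 2 * (q C + r C) \<in> \<int>"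
    by (simp_all add: scaleR_add_left sum.distrib distrib_left)
  then show ?thesis
    by (rule half_latticeI)
qed

lemma half_lattice_uminus:
  assumes "x \<in> half_lattice S"
  shows "- x \<in> half_lattice S"
proof -
  obtain q where "x = (\<Sum>C\<in>S. q C *\<^sub>R C)" "\<forall>C\<in>S. 2 * q C \<in> \<int>"
    using assms unfolding half_lattice_def by blast
  then have "- x = (\<Sum>C\<in>S. (- q C) *\<^sub>R C)" "\<forall>C\<in>S. 2 * (- q C) \<in> \<int>"
    by (simp_all add: sum_negf)
  then show ?thesis
    by (rule half_latticeI)
qed

lemma half_lattice_diff:
  "x \<in> half_lattice S \<Longrightarrow> y \<in> half_lattice S \<Longrightarrow> x - y \<in> half_lattice S"
  using half_lattice_add[of x S "- y"] half_lattice_uminus[of y S] by simp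

lemma finite_scheme_of: "finite (scheme_of M)"
proof (rule finite_subset)
  show "scheme_of M \<subseteq> range (sigma M) \<union> range (sigma' M)"
    unfolding scheme_of_def by blast
qed simp

lemma basis_in_half_lattice:
  assumes "admissible M" and "B \<in> basis_matrices M"
  shows "B \<in> half_lattice (scheme_of M)"
proof -
  note half = half_lattice_half[OF finite_scheme_of]
  show ?thesis
    using basis_half_sum[OF assms]
    by (auto simp: scaleR_add_right scaleR_diff_right intro: half half_lattice_add half_lattice_diff)
qed

lemma basis_product:
  fixes M :: "'g::{ab_group_add,finite} \<Rightarrow> 'g \<Rightarrow> int"
  assumes "\<forall>x::'g. x + x = 0" "admissible M" "B \<in> basis_matrices M" "C \<in> basis_matrices M"
  shows "jordan_product B C \<in> insert 0 (basis_matrices M)"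
proof -
  have swap: "jordan_product spin_unit (reg h) = 0" "jordan_product (gen M t) (reg h) = 0"
      "jordan_product (gen M t) spin_unit = gen M t" for h t
    by (simp_all add: jordan_product_commute[of spin_unit "reg _"]
        jordan_product_commute[of "gen _ _"] reg_spin_unit reg_gen spin_unit_gen)
  show ?thesis
    using assms(3,4) unfolding basis_matrices_def
    by (auto simp: swap reg_reg reg_spin_unit reg_gen spin_unit_spin_unit spin_unit_gen
        gen_gen[OF assms(1,2)])
qed

lemma scheme_product:
  fixes M :: "'g::{ab_group_add,finite} \<Rightarrow> 'g \<Rightarrow> int"
  assumes "\<forall>x::'g. x + x = 0" "admissible M" "A \<in> scheme_of M" "A' \<in> scheme_of M"
  shows "jordan_product A A' \<in> half_lattice (scheme_of M)"
proof -
  obtain B C where A: "B \<in> basis_matrices M" "C \<in> basis_matrices M" "A = B + C \<or> A = B - C"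
    using scheme_decomposition assms by blast
  obtain B' C' where A': "B' \<in> basis_matrices M" "C' \<in> basis_matrices M" "A' = B' + C' \<or> A' = B' - C'"
    using scheme_decomposition assms by blast
  have prod: "jordan_product X Y \<in> half_lattice (scheme_of M)"
    if "X \<in> basis_matrices M" "Y \<in> basis_matrices M" for X Y
    using basis_product[OF assms(1,2) that] basis_in_half_lattice[OF assms(2)] half_lattice_zero
    by auto
  note lin = bilinear_ladd[OF bilinear_jordan_product] bilinear_radd[OF bilinear_jordan_product]
    bilinear_lsub[OF bilinear_jordan_product] bilinear_rsub[OF bilinear_jordan_product]
  from A(3) A'(3) show ?thesis
    by (elim disjE) (simp_all only: lin half_lattice_add half_lattice_diff prod A A')
qed

text \<open>For a position in the matrix, the difference of the two points of \<open>H\<close> fixes the index \<open>(s, t)\<close>, and the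
  entry of the block then decides between \<open>sigma\<close> and \<open>sigma'\<close>. This yields the sum over the set \<open>S\<close> entry by entry.\<close>

lemma scheme_entry_unique:
  "\<exists>!A. A \<in> scheme_of M \<and> A $ p $ q = 1"
proof (rule ex_ex1I)
  obtain s t where st: "fst q = fst p + (s, t)"
    by (metis add.commute diff_add_cancel surj_pair)
  have in_S: "sigma M (0, t) \<in> scheme_of M" "sigma M (1, t) \<in> scheme_of M"
      "sigma' M (1, t) \<in> scheme_of M" "sigma' M (0, 0) \<in> scheme_of M"
    unfolding scheme_of_def by blast+
  show "\<exists>A. A \<in> scheme_of M \<and> A $ p $ q = 1"
  proof (cases "s = 0")
    case True
    then show ?thesis
      using in_S(1,4) st
      by (cases "t = 0 \<and> snd p \<noteq> snd q") (auto simp: sigma_entries)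
  next
    case False
    then have "s = 1"
      using two_cases by blast
    then show ?thesis
      using in_S(2,3) st
      by (cases "(signs M t (fst p) = 1) = (snd p = snd q)") (auto simp: sigma_entries)
  qed
next
  fix A B
  assume "A \<in> scheme_of M \<and> A $ p $ q = 1" "B \<in> scheme_of M \<and> B $ p $ q = 1"
  then show "A = B"
    unfolding scheme_of_def
    by (auto simp: sigma_entries zero_prod_def split: if_splits)
qed

lemma scheme_entry_01: "A \<in> scheme_of M \<Longrightarrow> A $ p $ q \<in> {0, 1}"
  unfolding scheme_of_def by (auto simp: sigma_entries split: if_splits)

lemma sum_scheme_of: "(\<Sum>A\<in>scheme_of M. A) = all_ones"
proof -
  have "(\<Sum>A\<in>scheme_of M. A $ p $ q) = 1" for p q
  proof -
    obtain B where B: "B \<in> scheme_of M" "B $ p $ q = 1"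
        and unique: "\<And>A. A \<in> scheme_of M \<Longrightarrow> A $ p $ q = 1 \<Longrightarrow> A = B"
      using scheme_entry_unique[of M p q] by blast
    have "(\<Sum>A\<in>scheme_of M. A $ p $ q) = (\<Sum>A\<in>scheme_of M. if A = B then 1 else 0)"
    proof (rule sum.cong[OF refl])
      fix A assume A: "A \<in> scheme_of M"
      show "A $ p $ q = (if A = B then 1 else 0)"
        using B(2) unique[OF A] scheme_entry_01[OF A, of p q] by (cases "A = B") auto
    qed
    then show ?thesis
      using B(1) by (simp add: finite_scheme_of)
  qed
  then show ?thesis
    by (simp add: vec_eq_iff all_ones_def)
qed

text \<open>In a group of exponent 2 each translation is an involution, and \<open>signs_shift\<close> makes the signs at its two
  ends agree.\<close>

lemma scheme_symmetric:
  fixes M :: "'g::{ab_group_add,finite} \<Rightarrow> 'g \<Rightarrow> int"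
  assumes "\<forall>x::'g. x + x = 0" "admissible M" "A \<in> scheme_of M"
  shows "transpose A = A"
proof -
  have "A $ q $ p = A $ p $ q" for p q
  proof -
    have "(s, t) + (s, t) = (0 :: 2 \<times> 'g)" for s t
      using assms(1) by (simp add: zero_prod_def two_add_self)
    then have "x + (s, t) + (s, t) = x" for x :: "2 \<times> 'g" and s t
      by (simp only: add.assoc) simp
    then have swap: "fst p = fst q + (s, t) \<longleftrightarrow> fst q = fst p + (s, t)" for s t
      by metis
    consider t where "A = sigma M (0, t)" | "A = sigma' M (0, 0)" | t where "A = sigma M (1, t)"
      | t where "A = sigma' M (1, t)"
      using assms(3) unfolding scheme_of_def by blast
    then show ?thesis
      by cases (simp_all add: sigma_entries swap signs_shift[OF assms(1,2)] eq_commute[of "fst p" "fst q"]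
          eq_commute[of "snd q" "snd p"] cong: conj_cong)
  qed
  then show ?thesis
    by (simp add: vec_eq_iff transpose_def)
qed

lemma jordan_scheme_scheme_of:
  fixes M :: "'g::{ab_group_add,finite} \<Rightarrow> 'g \<Rightarrow> int"
  assumes "\<forall>x::'g. x + x = 0" "admissible M"
  shows "jordan_scheme (scheme_of M)"
proof -
  have "mat 1 = sigma M (0, 0)"
    by (auto simp: vec_eq_iff mat_def sigma_entries prod_eq_iff)
  then have "mat 1 \<in> scheme_of M"
    by (simp add: scheme_of_def)
  moreover have "\<exists>p. \<forall>A\<in>scheme_of M. \<forall>B\<in>scheme_of M. (\<forall>C\<in>scheme_of M. 2 * p A B C \<in> \<int>) \<and>
      jordan_product A B = (\<Sum>C\<in>scheme_of M. p A B C *\<^sub>R C)"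
  proof -
    define p where "p A B = (SOME q. (\<forall>C\<in>scheme_of M. 2 * q C \<in> \<int>) \<and>
      jordan_product A B = (\<Sum>C\<in>scheme_of M. q C *\<^sub>R C))" for A B
    have "(\<forall>C\<in>scheme_of M. 2 * p A B C \<in> \<int>) \<and>
        jordan_product A B = (\<Sum>C\<in>scheme_of M. p A B C *\<^sub>R C)"
      if "A \<in> scheme_of M" "B \<in> scheme_of M" for A B
    proof -
      have "\<exists>q. (\<forall>C\<in>scheme_of M. 2 * q C \<in> \<int>) \<and>
          jordan_product A B = (\<Sum>C\<in>scheme_of M. q C *\<^sub>R C)"
        using scheme_product[OF assms that] unfolding half_lattice_def by blast
      then show ?thesis
        unfolding p_def by (rule someI_ex)
    qed
    then show ?thesis
      by blast
  qed
  ultimately show ?thesis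
    unfolding jordan_scheme_def
    by (intro conjI ballI allI finite_scheme_of scheme_symmetric[OF assms] scheme_entry_01
        sum_scheme_of)
qed

section \<open>The adjacency algebra\<close>

text \<open>On the diagonal only the summand of the neutral element contributes.\<close>

lemma idempotent_reg_nonzero:
  fixes \<kappa> :: "2 \<times> 'g::{ab_group_add,finite} \<Rightarrow> 2 \<times> 'g \<Rightarrow> real"
  assumes "character_pairing \<kappa>"
  shows "character_pairing.idempotent \<kappa> reg c \<noteq> 0"
proof
  interpret character_pairing \<kappa> by fact
  define p where "p = ((0 :: 2, 0 :: 'g), 0 :: 2)"
  assume "idempotent reg c = 0"
  then have "idempotent reg c $ p $ p = 0"
    by simp
  moreover have "\<kappa> c h *\<^sub>R (reg h $ p $ p) = (if h = 0 then 1/2 else 0)" for h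
    by (simp add: reg_entry scaleR_conv_of_real)
  ultimately show False
    by (simp add: idempotent_def)
qed

theorem theorem5p2:
  fixes M :: "'g::{ab_group_add,finite} \<Rightarrow> 'g \<Rightarrow> int"
  assumes elementary_abelian: "\<forall>x::'g. x + x = 0"
    and order: "CARD('g) = 4"
    and M: "admissible M"
  shows "jordan_scheme (scheme_of M) \<and>
    jordan_algebra_iso
      (adjacency_algebra (scheme_of M)) jordan_product
      (UNIV :: ((real^8) \<times> (real \<times> (real^4))) set)
      (direct_sum_product (\<lambda>u v. \<chi> i. u $ i * v $ i)
         (spin_product (\<lambda>x y. \<Sum>i\<in>UNIV. x $ i * y $ i)))"
proof
  show "jordan_scheme (scheme_of M)"
    using jordan_scheme_scheme_of elementary_abelian M by blast
  interpret character_pairing "pairing :: 2 \<times> 'g \<Rightarrow> _"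
    using character_pairing elementary_abelian order by blast
  (* The coordinates of the two summands are numbered by H and by G. *)
  obtain \<beta> :: "8 \<Rightarrow> 2 \<times> 'g" where \<beta>: "bij \<beta>"
    using finite_same_card_bij[of "UNIV :: 8 set" "UNIV :: (2 \<times> 'g) set"] order
    by (auto simp: card_cartesian_product simp flip: UNIV_Times_UNIV)
  obtain \<gamma> :: "4 \<Rightarrow> 'g" where \<gamma>: "bij \<gamma>"
    using finite_same_card_bij[of "UNIV :: 4 set" "UNIV :: 'g set"] order by auto
  define E where "E = (\<lambda>i. idempotent reg (\<beta> i))"
  define w where "w = (\<lambda>j. gen M (\<gamma> j))"
  have orth: "jordan_product (idempotent reg c) X = 0" if "\<And>h. jordan_product (reg h) X = 0" for c X
  proof -
    have lin: "linear (\<lambda>A. jordan_product A X)"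
      by (rule bilinear_jordan_product[unfolded bilinear_def, THEN conjunct2, rule_format])
    show ?thesis
      unfolding idempotent_def linear_scale[OF lin] linear_sum[OF lin] that by simp
  qed
  interpret jordan_frame jordan_product E "spin_unit" w
  proof
    show "jordan_product (E i) (E k) = (if i = k then E i else 0)" for i k
      using bij_is_inj[OF \<beta>]
      by (simp add: E_def idempotent_mult[where R = reg, OF bilinear_jordan_product reg_reg] inj_eq)
    show "jordan_product (w j) (w l) = (if j = l then spin_unit else 0)" for j l
      using bij_is_inj[OF \<gamma>] by (simp add: w_def gen_gen[OF elementary_abelian M] inj_eq)
    show "jordan_product (E i) spin_unit = 0" "jordan_product (E i) (w j) = 0" for i j
      unfolding E_def w_def by (intro orth reg_spin_unit reg_gen)+
    show "jordan_product spin_unit (w j) = w j" for j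
      unfolding w_def by (rule spin_unit_gen)
  qed (rule bilinear_jordan_product jordan_product_commute spin_unit_spin_unit)+
  have "range E = idempotent reg ` range \<beta>" "range w = gen M ` range \<gamma>"
    unfolding E_def w_def by (simp_all only: image_image)
  then have "range E = range (idempotent reg)" "range w = range (gen M)"
    by (simp_all only: bij_is_surj[OF \<beta>] bij_is_surj[OF \<gamma>])
  then have "range (frame_map E spin_unit w) = span (basis_matrices M)"
    by (simp only: range_frame_map basis_matrices_def span_Un span_idempotent)
  then have range: "range (frame_map E spin_unit w) = adjacency_algebra (scheme_of M)"
    by (simp add: adjacency_algebra_def span_basis_matrices[OF M])
  have "spin_unit $ ((0 :: 2, 0 :: 'g), 0) $ ((0, 0), 0) \<noteq> 0"
    by (simp add: spin_unit_entry)
  then have "spin_unit \<noteq> (0 :: complex^((2 \<times> 'g) \<times> 2)^((2 \<times> 'g) \<times> 2))"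
    by auto
  then have inj: "inj (frame_map E spin_unit w)"
    using idempotent_reg_nonzero[OF character_pairing_axioms]
    by (intro inj_frame_map) (simp_all add: E_def)
  have "jordan_product A B \<in> range (frame_map E spin_unit w)"
    if "A \<in> range (frame_map E spin_unit w)" "B \<in> range (frame_map E spin_unit w)" for A B
    using that by (elim rangeE) (simp only: frame_map_mult[symmetric] rangeI)
  moreover have "subspace (range (frame_map E spin_unit w))"
    by (rule linear_subspace_image[OF linear_frame_map subspace_UNIV])
  ultimately have alg: "jordan_algebra (adjacency_algebra (scheme_of M)) jordan_product"
    unfolding range by (intro jordan_algebra_of_matrices)
  show "jordan_algebra_iso (adjacency_algebra (scheme_of M)) jordan_product
      (UNIV :: ((real^8) \<times> (real \<times> (real^4))) set)
      (direct_sum_product (\<lambda>u v. \<chi> i. u $ i * v $ i)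
         (spin_product (\<lambda>x y. \<Sum>i\<in>UNIV. x $ i * y $ i)))"
    by (rule jordan_algebra_iso_range[OF alg linear_frame_map inj range], rule frame_map_mult)
qed

end
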